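(* Let $f_1,\dots,f_s\in\mathbb{F}_q\langle X^q\rangle$ have $q$-degrees $d_1,\dots,d_s$, let $n=\sum_i d_i$, and assume that each $f_i$ is coprime with the least left common multiple $b_i$ of the $f_j$, $j\ne i$. Then for every $e\in\prod_{i=1}^s\mathbb{F}_{q^m}\langle X^q\rangle_{d_i}$, the Chinese Remainder lifting $\Phi$ satisfies $$\operatorname{supp}(\Phi(e))\subset\operatorname{supp}(e).$$
   Context: Let $q$ be a prime power and $m\ge1$. $\mathbb{F}_{q^m}\langle X^q\rangle$ is the set of linearized polynomials $\sum_{i=0}^d p_iX^{q^i}$, $p_i\in\mathbb{F}_{q^m}$, a non-commutative ring under addition and composition $\circ$, determined by $(aX^{q^i})\circ(bX^{q^j})=ab^{q^i}X^{q^{i+j}}$, with unit $X$; $\mathbb{F}_q\langle X^q\rangle$ is the subset with coefficients in $\mathbb{F}_q$. The $q$-degree of a nonzero element is the largest $i$ such that the coefficient of $X^{q^i}$ is nonzero; $\mathbb{F}_{q^m}\langle X^q\rangle_t$ is the set of elements of $q$-degree $<t$ (including $0$). Coprime means that the greatest right common divisor is $X$ (up to scalar); the least left common multiple is a generator of the intersection of the left ideals generated. $\Phi:\prod_{i=1}^s\mathbb{F}_{q^m}\langle X^q\rangle_{d_i}\to\mathbb{F}_{q^m}\langle X^q\rangle_n$ is the Chinese Remainder lifting: $\Phi(p_1,\dots,p_s)$ is the remainder of the right division of $\sum_{i}p_i\circ S_{1,i}\circ b_i$ by the least left common multiple of $f_1,\dots,f_s$, where $S_{1,i}\circ b_i+S_{2,i}\circ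 f_i=X$. Equivalently, it satisfies $\Phi(\pi_1(p),\dots,\pi_s(p))=p$ for all $p$ of $q$-degree $<n$, $\pi_i(p)$ being the remainder of the right division of $p$ by $f_i$. The support $\operatorname{supp}$ of a linearized polynomial is the $\mathbb{F}_q$-subspace of $\mathbb{F}_{q^m}$ spanned by its coefficients; the support of $e=(e_1,\dots,e_s)$ is the $\mathbb{F}_q$-subspace spanned by all coefficients of all $e_i$. *)

theory Defs
  imports
    "HOL-Computational_Algebra.Polynomial"
    "HOL-Number_Theory.Prime_Powers"
    "HOL-Library.Cardinality"
begin

definition subfield_set :: "'a::field set \<Rightarrow> bool" where
  "subfield_set K \<longleftrightarrow> 0 \<in> K \<and> 1 \<in> K \<and>
     (\<forall>x\<in>K. \<forall>y\<in>K. x + y \<in> K \<and> x * y \<in> K) \<and>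
     (\<forall>x\<in>K. - x \<in> K \<and> inverse x \<in> K)"

text \<open>
  Linearized polynomials are ordinary polynomials whose exponents are all powers of \<open>q\<close>;
  the ring operations are polynomial addition and \<^const>\<open>pcompose\<close>, and the unit is \<open>X = [:0, 1:]\<close>.
  The ambient type plays the role of the field with \<open>q ^ m\<close> elements.
\<close>

definition linearized :: "nat \<Rightarrow> 'a::field set \<Rightarrow> 'a poly set" where
  "linearized q K = {p. (\<forall>k. coeff p k \<noteq> 0 \<longrightarrow> (\<exists>i. k = q ^ i)) \<and> (\<forall>k. coeff p k \<in> K)}"

abbreviation lin_polys :: "nat \<Rightarrow> 'a::field poly set" where
  "lin_polys q \<equiv> linearized q UNIV"

lemma pcompose_monom_q_powers:
  fixes a b :: "'a::field"
  shows "pcompose (monom a (q ^ i)) (monom b (q ^ j)) = monom (a * b ^ (q ^ i)) (q ^ (i + j))"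
  by (simp add: pcompose_altdef map_poly_monom poly_monom monom_power smult_monom power_add mult.commute)

text \<open>Only meaningful for nonzero linearized polynomials and \<open>q \<ge> 2\<close>.\<close>

definition qdegree :: "nat \<Rightarrow> 'a::field poly \<Rightarrow> nat" where
  "qdegree q p = Max {i. coeff p (q ^ i) \<noteq> 0}"

definition lin_polys_lt :: "nat \<Rightarrow> nat \<Rightarrow> 'a::field poly set" where
  "lin_polys_lt q t = {p \<in> lin_polys q. p = 0 \<or> qdegree q p < t}"

definition left_ideal :: "nat \<Rightarrow> 'a::field poly \<Rightarrow> 'a poly set" where
  "left_ideal q f = {pcompose h f | h. h \<in> lin_polys q}"

definition right_divides :: "nat \<Rightarrow> 'a::field poly \<Rightarrow> 'a poly \<Rightarrow> bool" where
  "right_divides q g p \<longleftrightarrow> (\<exists>h\<in>lin_polys q. p = pcompose h g)"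

definition is_gcrd :: "nat \<Rightarrow> 'a::field poly \<Rightarrow> 'a poly \<Rightarrow> 'a poly \<Rightarrow> bool" where
  "is_gcrd q a b g \<longleftrightarrow> g \<in> lin_polys q \<and> right_divides q g a \<and> right_divides q g b \<and>
     (\<forall>h\<in>lin_polys q. right_divides q h a \<and> right_divides q h b \<longrightarrow> right_divides q h g)"

definition right_coprime :: "nat \<Rightarrow> 'a::field poly \<Rightarrow> 'a poly \<Rightarrow> bool" where
  "right_coprime q a b \<longleftrightarrow> (\<exists>c. c \<noteq> 0 \<and> is_gcrd q a b (smult c [:0, 1:]))"

text \<open>
  Least left common multiples are determined only up to a nonzero scalar, hence a predicate.
  For an empty family the intersection is the whole ring.
\<close>

definition is_lclm :: "nat \<Rightarrow> 'a::field poly set \<Rightarrow> 'a poly \<Rightarrow> bool" where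
  "is_lclm q F g \<longleftrightarrow> g \<in> lin_polys q \<and>
     left_ideal q g = lin_polys q \<inter> (\<Inter>f\<in>F. left_ideal q f)"

definition is_right_remainder :: "nat \<Rightarrow> 'a::field poly \<Rightarrow> 'a poly \<Rightarrow> 'a poly \<Rightarrow> bool" where
  "is_right_remainder q p g r \<longleftrightarrow> r \<in> lin_polys_lt q (qdegree q g) \<and>
     (\<exists>h\<in>lin_polys q. p = pcompose h g + r)"

text \<open>
  The definite description ranges over all choices of Bezout coefficients \<open>S1\<close>, \<open>S2\<close> and of the
  least left common multiple \<open>l\<close>; it denotes a remainder because one exists and does not depend on
  these choices.
\<close>

definition crt_lift ::
  "nat \<Rightarrow> nat \<Rightarrow> (nat \<Rightarrow> 'a::field poly) \<Rightarrow> (nat \<Rightarrow> 'a poly) \<Rightarrow> (nat \<Rightarrow> 'a poly) \<Rightarrow> 'a poly" where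
  "crt_lift q s f b e = (THE r. \<exists>S1 S2 l.
     (\<forall>i\<in>{1..s}. S1 i \<in> lin_polys q \<and> S2 i \<in> lin_polys q \<and>
        pcompose (S1 i) (b i) + pcompose (S2 i) (f i) = [:0, 1:]) \<and>
     is_lclm q (f ` {1..s}) l \<and>
     is_right_remainder q (\<Sum>i=1..s. pcompose (pcompose (e i) (S1 i)) (b i)) l r)"

definition subspace_over :: "'a::field set \<Rightarrow> 'a set \<Rightarrow> bool" where
  "subspace_over K V \<longleftrightarrow> 0 \<in> V \<and> (\<forall>x\<in>V. \<forall>y\<in>V. x + y \<in> V) \<and> (\<forall>c\<in>K. \<forall>x\<in>V. c * x \<in> V)"

definition span_over :: "'a::field set \<Rightarrow> 'a set \<Rightarrow> 'a set" where
  "span_over K A = subspace_over K hull A"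

definition supp :: "'a::field set \<Rightarrow> 'a poly \<Rightarrow> 'a set" where
  "supp K p = span_over K (range (coeff p))"

definition supp_tuple :: "'a::field set \<Rightarrow> nat \<Rightarrow> (nat \<Rightarrow> 'a poly) \<Rightarrow> 'a set" where
  "supp_tuple K s e = span_over K (\<Union>i\<in>{1..s}. range (coeff (e i)))"

end

theory Submission
  imports Defs
begin

text \<open>
  A lift \<open>r\<close> of \<open>e\<close> is characterised by its \<open>q\<close>-degree being smaller than that of the least left
  common multiple and by \<open>r - e\<^sub>i\<close> lying in the left ideal of \<open>f\<^sub>i\<close> for all \<open>i\<close>.  An \<open>F\<^sub>q\<close>-linear
  map \<open>\<phi>\<close> applied to coefficients commutes with right composition by polynomials over \<open>F\<^sub>q\<close>,
  so \<open>\<phi>(r)\<close> is the lift of the \<open>\<phi>(e\<^sub>i)\<close>.  If \<open>\<phi>\<close> vanishes on the support of \<open>e\<close>, then \<open>\<phi>(r)\<close> is the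
  lift of \<open>0\<close>, hence \<open>0\<close>; and the support of \<open>e\<close> is an intersection of kernels of such maps.
\<close>

section \<open>Linear functionals over a subfield\<close>

lemma subspace_over_span_over: "subspace_over K (span_over K A)"
  unfolding span_over_def by (rule hull_in) (auto simp: subspace_over_def)

lemma subspace_over_minus:
  assumes "subfield_set K" "subspace_over K V" "x \<in> V" "y \<in> V"
  shows "x - y \<in> V"
proof -
  have "-1 \<in> K"
    using assms(1) by (auto simp: subfield_set_def)
  then have "-1 * y \<in> V"
    using assms(2,4) unfolding subspace_over_def by blast
  then have "x + -1 * y \<in> V"
    using assms(2,3) unfolding subspace_over_def by blast
  then show ?thesis by simp
qed

text \<open>By finiteness there is a subspace \<open>W\<close> maximal among those that contain
  \<open>V\<close> and miss \<open>x\<close>. It complements the line spanned by \<open>x\<close>,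
  and \<open>\<phi>\<close> is the coordinate along \<open>x\<close> modulo
  \<open>W\<close>.\<close>

lemma exists_separating_functional:
  fixes K V :: "'a::field set"
  assumes fin: "finite (UNIV :: 'a set)" and K: "subfield_set K"
    and V: "subspace_over K V" and x: "x \<notin> V"
  obtains \<phi> :: "'a \<Rightarrow> 'a" where
    "\<And>a b. \<phi> (a + b) = \<phi> a + \<phi> b" "\<And>c a. c \<in> K \<Longrightarrow> \<phi> (c * a) = c * \<phi> a"
    "\<And>v. v \<in> V \<Longrightarrow> \<phi> v = 0" "\<phi> x \<noteq> 0"
proof -
  define \<W> where "\<W> = {W. subspace_over K W \<and> V \<subseteq> W \<and> x \<notin> W}"
  have "finite \<W>"
    by (rule finite_subset[of _ UNIV]) (simp_all add: fin Finite_Set.finite_set)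
  moreover have "V \<in> \<W>"
    using V x by (simp add: \<W>_def)
  ultimately have "\<exists>W\<in>\<W>. V \<subseteq> W \<and> (\<forall>U\<in>\<W>. W \<subseteq> U \<longrightarrow> W = U)"
    by (rule finite_has_maximal2)
  then obtain W where "W \<in> \<W>" and max: "\<And>U. U \<in> \<W> \<Longrightarrow> W \<subseteq> U \<Longrightarrow> W = U"
    by auto
  then have W: "subspace_over K W" and VW: "V \<subseteq> W" and xW: "x \<notin> W"
    by (auto simp: \<W>_def)
  have W0 [simp]: "0 \<in> W" and W_add: "\<And>a b. a \<in> W \<Longrightarrow> b \<in> W \<Longrightarrow> a + b \<in> W"
    and W_mult: "\<And>c a. c \<in> K \<Longrightarrow> a \<in> W \<Longrightarrow> c * a \<in> W"
    using W by (auto simp: subspace_over_def)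
  have K0 [simp]: "0 \<in> K" and K1 [simp]: "1 \<in> K"
    and K_add: "\<And>a b. a \<in> K \<Longrightarrow> b \<in> K \<Longrightarrow> a + b \<in> K"
    and K_mult: "\<And>a b. a \<in> K \<Longrightarrow> b \<in> K \<Longrightarrow> a * b \<in> K"
    and K_minus: "\<And>a. a \<in> K \<Longrightarrow> - a \<in> K" and K_inv: "\<And>a. a \<in> K \<Longrightarrow> inverse a \<in> K"
    using K by (auto simp: subfield_set_def)
  have unique: "c = d" if "c \<in> K" "d \<in> K" "y - c * x \<in> W" "y - d * x \<in> W" for c d y
  proof (rule ccontr)
    assume "c \<noteq> d"
    \<comment> \<open>The difference is written \<open>c + - d\<close> to fit the closure rules of
      \<open>K\<close>, which speak of sums and negatives. Scaling by its inverse would put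
      \<open>x\<close> into \<open>W\<close>.\<close>
    have "inverse (c + - d) * ((y - d * x) - (y - c * x)) \<in> W"
      using that by (intro W_mult K_inv K_add K_minus subspace_over_minus[OF K W that(4,3)])
    also have "inverse (c + - d) * ((y - d * x) - (y - c * x)) = x"
      using \<open>c \<noteq> d\<close> by (simp add: divide_simps) (simp add: algebra_simps)
    finally show False using xW by simp
  qed
  have exist: "\<exists>c\<in>K. y - c * x \<in> W" for y
  proof (cases "y \<in> W")
    case True
    then show ?thesis by (intro bexI[of _ 0]) auto
  next
    case False
    \<comment> \<open>As \<open>y\<close> lies outside \<open>W\<close>, maximality puts
      \<open>x\<close> into the span of \<open>W\<close> and \<open>y\<close>. The coefficient of
      \<open>y\<close> is nonzero because \<open>x\<close> is not in \<open>W\<close>, so the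
      relation can be solved for \<open>y\<close>.\<close>
    define U where "U = {w + c * y | w c. w \<in> W \<and> c \<in> K}"
    have "subspace_over K U"
      unfolding subspace_over_def
    proof (intro conjI ballI)
      show "0 \<in> U"
        unfolding U_def by (rule CollectI, rule exI[of _ 0], rule exI[of _ 0]) simp
    next
      fix a b assume "a \<in> U" "b \<in> U"
      then obtain w c w' c' where "a = w + c * y" "b = w' + c' * y" "w \<in> W" "w' \<in> W" "c \<in> K" "c' \<in> K"
        unfolding U_def by blast
      then show "a + b \<in> U"
        unfolding U_def
        by (intro CollectI exI[of _ "w + w'"] exI[of _ "c + c'"]) (simp add: W_add K_add algebra_simps)
    next
      fix k a assume "k \<in> K" "a \<in> U"
      then obtain w c where "a = w + c * y" "w \<in> W" "c \<in> K"
        unfolding U_def by blast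
      with \<open>k \<in> K\<close> show "k * a \<in> U"
        unfolding U_def
        by (intro CollectI exI[of _ "k * w"] exI[of _ "k * c"]) (simp add: W_mult K_mult algebra_simps)
    qed
    moreover have WU: "W \<subseteq> U"
    proof
      fix w assume "w \<in> W"
      then show "w \<in> U"
        unfolding U_def by (intro CollectI exI[of _ w] exI[of _ 0]) simp
    qed
    moreover have "y \<in> U"
      unfolding U_def by (rule CollectI, rule exI[of _ 0], rule exI[of _ 1]) simp
    ultimately have "x \<in> U"
      using max[of U] False VW unfolding \<W>_def by blast
    then obtain w c where wc: "x = w + c * y" "w \<in> W" "c \<in> K"
      unfolding U_def by blast
    then have "c \<noteq> 0" using xW by auto
    have "0 - inverse c * w \<in> W"
      using wc by (intro subspace_over_minus[OF K W] W0 W_mult K_inv)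
    also have "0 - inverse c * w = y - inverse c * x"
      using wc \<open>c \<noteq> 0\<close> by (simp add: field_simps)
    finally show ?thesis using wc K_inv by blast
  qed
  \<comment> \<open>Each property of \<open>\<phi>\<close> follows by exhibiting a second admissible
    coefficient in \<open>K\<close> and applying \<open>unique\<close>.\<close>
  from exist obtain \<phi> where \<phi>: "\<And>y. \<phi> y \<in> K" "\<And>y. y - \<phi> y * x \<in> W"
    by metis
  show ?thesis
  proof (rule that)
    fix a b
    have "(a - \<phi> a * x) + (b - \<phi> b * x) \<in> W"
      by (intro W_add \<phi>)
    then have "(a + b) - (\<phi> a + \<phi> b) * x \<in> W"
      by (simp add: algebra_simps)
    then show "\<phi> (a + b) = \<phi> a + \<phi> b"
      using unique \<phi> K_add by blast
  next
    fix c a assume c: "c \<in> K"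
    have "c * (a - \<phi> a * x) \<in> W"
      by (intro W_mult c \<phi>)
    then have "c * a - (c * \<phi> a) * x \<in> W"
      by (simp add: algebra_simps)
    then show "\<phi> (c * a) = c * \<phi> a"
      using unique \<phi> K_mult c by blast
  next
    fix v assume "v \<in> V"
    then have "v - 0 * x \<in> W" using VW by auto
    then show "\<phi> v = 0"
      using unique \<phi> K0 by blast
  next
    have "x - 1 * x \<in> W" by simp
    then have "\<phi> x = 1"
      using unique \<phi> K1 by blast
    then show "\<phi> x \<noteq> 0" by simp
  qed
qed

text \<open>By the Horner recursion
  \<open>pcompose (pCons a h) f = [:a:] + f * pcompose h f\<close>, it suffices that
  \<open>\<phi>\<close> commutes with multiplication by \<open>f\<close>. It does, because the
  coefficients of \<open>f\<close> are scalars from \<open>K\<close>.\<close>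

lemma map_poly_pcompose_linear:
  fixes \<phi> :: "'a::field \<Rightarrow> 'a"
  assumes add: "\<And>a b. \<phi> (a + b) = \<phi> a + \<phi> b"
    and mult: "\<And>c a. c \<in> K \<Longrightarrow> \<phi> (c * a) = c * \<phi> a"
    and f: "\<And>k. coeff f k \<in> K"
  shows "map_poly \<phi> (pcompose h f) = pcompose (map_poly \<phi> h) f"
proof -
  have zero: "\<phi> 0 = 0"
    using add[of 0 0] by (metis add.right_neutral add_cancel_left_right)
  have sum: "\<phi> (sum g A) = (\<Sum>x\<in>A. \<phi> (g x))" for g and A :: "nat set"
    by (induction A rule: infinite_finite_induct) (simp_all add: zero add)
  have map_mult: "map_poly \<phi> (f * p) = f * map_poly \<phi> p" for p
    by (rule poly_eqI) (simp add: coeff_map_poly zero coeff_mult sum mult f)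
  have map_add: "map_poly \<phi> (p + r) = map_poly \<phi> p + map_poly \<phi> r" for p r
    by (rule poly_eqI) (simp add: coeff_map_poly zero add)
  show ?thesis
  proof (induction h)
    case 0
    show ?case by simp
  next
    case (pCons a h)
    have "map_poly \<phi> [:a:] = [:\<phi> a:]"
      by (rule poly_eqI) (simp add: coeff_map_poly zero coeff_pCons split: nat.splits)
    with pCons show ?case
      by (simp add: pcompose_pCons map_add map_mult map_poly_pCons zero)
  qed
qed


section \<open>The ring of linearized polynomials\<close>

lemma lin_polys_iff: "p \<in> lin_polys q \<longleftrightarrow> (\<forall>k. coeff p k \<noteq> 0 \<longrightarrow> (\<exists>i. k = q ^ i))"
  by (simp add: linearized_def)

lemma lin_polys_0 [simp]: "0 \<in> lin_polys q"
  by (simp add: lin_polys_iff)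

lemma lin_polys_monom [simp]: "monom a (q ^ i) \<in> lin_polys q"
  by (auto simp: lin_polys_iff)

lemma lin_polys_X [simp]: "[:0, 1:] \<in> lin_polys q"
  using lin_polys_monom[of 1 q 0] by (simp add: monom_altdef)

lemma lin_polys_add: "p \<in> lin_polys q \<Longrightarrow> r \<in> lin_polys q \<Longrightarrow> p + r \<in> lin_polys q"
  unfolding lin_polys_iff by (metis add.right_neutral coeff_add)

lemma lin_polys_uminus: "p \<in> lin_polys q \<Longrightarrow> - p \<in> lin_polys q"
  unfolding lin_polys_iff by simp

lemma lin_polys_diff: "p \<in> lin_polys q \<Longrightarrow> r \<in> lin_polys q \<Longrightarrow> p - r \<in> lin_polys q"
  using lin_polys_add[of p q "- r"] lin_polys_uminus[of r q] by simp

lemma lin_polys_smult: "p \<in> lin_polys q \<Longrightarrow> smult c p \<in> lin_polys q"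
  unfolding lin_polys_iff by simp

lemma lin_polys_sum: "(\<And>i. i \<in> A \<Longrightarrow> g i \<in> lin_polys q) \<Longrightarrow> sum g A \<in> lin_polys q"
  by (induction A rule: infinite_finite_induct) (simp_all add: lin_polys_add)

lemma lin_polys_map_poly: "p \<in> lin_polys q \<Longrightarrow> \<phi> 0 = 0 \<Longrightarrow> map_poly \<phi> p \<in> lin_polys q"
  unfolding lin_polys_iff by (metis coeff_map_poly)

text \<open>An element is the sum of its monomials; those whose exponent is not a power of
  \<open>q\<close> vanish. This reduces identities to monomials, where composition is a scaled
  power.\<close>

lemma lin_polys_induct [consumes 1, case_names zero monom add]:
  assumes p: "p \<in> lin_polys q" and "P 0" "\<And>a i. P (monom a (q ^ i))"
    and "\<And>u v. u \<in> lin_polys q \<Longrightarrow> v \<in> lin_polys q \<Longrightarrow> P u \<Longrightarrow> P v \<Longrightarrow> P (u + v)"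
  shows "P p"
proof -
  have monoms: "monom (coeff p k) k \<in> lin_polys q \<and> P (monom (coeff p k) k)" for k
  proof (cases "coeff p k = 0")
    case False
    then obtain i where "k = q ^ i" using p by (auto simp: lin_polys_iff)
    then show ?thesis using assms by auto
  qed (use assms in auto)
  have "P (\<Sum>k\<le>n. monom (coeff p k) k)" for n
  proof (induction n)
    case (Suc n)
    have "(\<Sum>k\<le>n. monom (coeff p k) k) \<in> lin_polys q"
      using monoms by (intro lin_polys_sum) auto
    with Suc monoms show ?case by (auto intro: assms)
  qed (use monoms in simp)
  from this[of "degree p"] show ?thesis
    by (simp add: poly_as_sum_of_monoms)
qed

section \<open>Degree and \<open>q\<close>-degree\<close>

lemma pcompose_monom: "pcompose (monom a n) p = smult a (p ^ n)" for p :: "'a::field poly"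
  by (simp add: pcompose_altdef map_poly_monom poly_monom)

lemma degree_lin_poly: "p \<in> lin_polys q \<Longrightarrow> p \<noteq> 0 \<Longrightarrow> \<exists>i. degree p = q ^ i"
  using leading_coeff_neq_0[of p] unfolding lin_polys_iff by blast

text \<open>Since \<open>1 < q\<close>, the exponents \<open>q ^ i\<close> grow strictly with
  \<open>i\<close>, so the top exponent belongs to the top index. Bounds on \<open>q\<close>-degrees
  thus become bounds on ordinary degrees.\<close>

lemma degree_eq_qdegree:
  assumes "1 < q" "p \<in> lin_polys q" "p \<noteq> 0"
  shows "degree p = q ^ qdegree q p"
proof -
  obtain i where i: "degree p = q ^ i"
    using degree_lin_poly assms by blast
  have le: "j \<le> i" if "coeff p (q ^ j) \<noteq> 0" for j
    using le_degree[OF that] assms(1) by (simp add: i)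
  have "qdegree q p = i"
    unfolding qdegree_def
  proof (rule Max_eqI)
    show "finite {j. coeff p (q ^ j) \<noteq> 0}"
      by (rule finite_subset[of _ "{..i}"]) (auto intro: le)
    show "i \<in> {j. coeff p (q ^ j) \<noteq> 0}"
      using assms(3) by (simp flip: i)
  qed (auto intro: le)
  with i show ?thesis by simp
qed

lemma lin_polys_lt_qdegree_iff:
  assumes "1 < q" "g \<in> lin_polys q" "g \<noteq> 0"
  shows "p \<in> lin_polys_lt q (qdegree q g) \<longleftrightarrow> p \<in> lin_polys q \<and> (p = 0 \<or> degree p < degree g)"
  by (cases "p = 0 \<or> p \<notin> lin_polys q")
    (use assms in \<open>auto simp: lin_polys_lt_def degree_eq_qdegree\<close>)

lemma finite_degree_le:
  assumes "finite (UNIV :: 'a::zero set)"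
  shows "finite {p :: 'a poly. degree p \<le> n}"
proof (rule finite_subset)
  show "{p :: 'a poly. degree p \<le> n} \<subseteq> Poly ` {xs. set xs \<subseteq> UNIV \<and> length xs \<le> Suc n}"
  proof
    fix p :: "'a poly" assume "p \<in> {p. degree p \<le> n}"
    then have "length (coeffs p) \<le> Suc n"
      by (cases "p = 0") (simp_all add: length_coeffs)
    then show "p \<in> Poly ` {xs. set xs \<subseteq> UNIV \<and> length xs \<le> Suc n}"
      by (intro image_eqI[of _ _ "coeffs p"]) simp_all
  qed
qed (intro finite_imageI finite_lists_length_le assms)

section \<open>Composition when the \<open>q\<close>-th power is additive\<close>

context
  fixes q :: nat
  assumes q_gt_1: "1 < q"
    and power_q_add: "\<And>x y :: 'a::field poly. (x + y) ^ q = x ^ q + y ^ q"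
begin

lemma power_q_power_add: "(x + y) ^ (q ^ i) = x ^ (q ^ i) + y ^ (q ^ i)" for x y :: "'a poly"
  by (induction i) (simp_all add: power_mult power_q_add mult.commute[of q])

text \<open>This distributive law depends on \<open>h\<close> being linearized: its monomials act as
  scaled powers of the additive \<open>q\<close>-th power map. The other law,
  \<open>pcompose_add\<close>, holds for all polynomials.\<close>

lemma pcompose_add_right:
  fixes h x y :: "'a poly"
  assumes "h \<in> lin_polys q"
  shows "pcompose h (x + y) = pcompose h x + pcompose h y"
  using assms
  by (induction rule: lin_polys_induct)
    (simp_all add: pcompose_monom power_q_power_add smult_add_right pcompose_add algebra_simps)

lemma pcompose_diff_right:
  fixes h x y :: "'a poly"
  assumes "h \<in> lin_polys q"
  shows "pcompose h (x - y) = pcompose h x - pcompose h y"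
  using pcompose_add_right[OF assms, of "x - y" y] by simp

lemma pcompose_0_right: "h \<in> lin_polys q \<Longrightarrow> pcompose h 0 = (0 :: 'a poly)"
  using pcompose_diff_right[of h 0 0] by simp

lemma lin_polys_power:
  fixes g :: "'a poly"
  assumes "g \<in> lin_polys q"
  shows "g ^ (q ^ i) \<in> lin_polys q"
  using assms
proof (induction rule: lin_polys_induct)
  case zero
  then show ?case using q_gt_1 by (simp add: power_0_left)
next
  case (monom a j)
  then show ?case by (simp add: monom_power flip: power_add)
next
  case (add u v)
  then show ?case by (simp add: power_q_power_add lin_polys_add)
qed

lemma lin_polys_pcompose:
  fixes h g :: "'a poly"
  assumes "h \<in> lin_polys q" "g \<in> lin_polys q"
  shows "pcompose h g \<in> lin_polys q"
  using assms(1)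
  by (induction rule: lin_polys_induct)
    (simp_all add: pcompose_monom lin_polys_smult lin_polys_power assms(2) pcompose_add lin_polys_add)

section \<open>Left ideals, right division and Bezout identities\<close>

lemma left_ideal_0_mem [simp]: "0 \<in> left_ideal q (g :: 'a poly)"
  unfolding left_ideal_def by (auto intro: exI[of _ 0])

lemma left_ideal_generator: "g \<in> left_ideal q (g :: 'a poly)"
proof -
  have "pcompose [:0, 1:] g = g"
    using pcompose_monom[of 1 1 g] by (simp add: monom_altdef)
  then show ?thesis
    unfolding left_ideal_def using lin_polys_X by (metis (mono_tags, lifting) mem_Collect_eq)
qed

lemma left_ideal_add:
  "x \<in> left_ideal q g \<Longrightarrow> y \<in> left_ideal q g \<Longrightarrow> x + y \<in> left_ideal q (g :: 'a poly)"
  unfolding left_ideal_def by (auto simp flip: pcompose_add intro: lin_polys_add)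

lemma left_ideal_diff:
  "x \<in> left_ideal q g \<Longrightarrow> y \<in> left_ideal q g \<Longrightarrow> x - y \<in> left_ideal q (g :: 'a poly)"
  unfolding left_ideal_def by (auto simp flip: pcompose_diff intro: lin_polys_diff)

lemma left_ideal_sum:
  "(\<And>i. i \<in> A \<Longrightarrow> x i \<in> left_ideal q g) \<Longrightarrow> sum x A \<in> left_ideal q (g :: 'a poly)"
  by (induction A rule: infinite_finite_induct) (simp_all add: left_ideal_add)

lemma left_ideal_pcompose:
  "h \<in> lin_polys q \<Longrightarrow> x \<in> left_ideal q g \<Longrightarrow> pcompose h x \<in> left_ideal q (g :: 'a poly)"
  unfolding left_ideal_def by (auto simp: pcompose_assoc intro: lin_polys_pcompose)

text \<open>Degrees multiply under composition, and a nonzero linearized polynomial has degree at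
  least 1, so composing with it on the left cannot lower the degree. Uniqueness of remainders rests
  on this.\<close>

lemma left_ideal_degree_less:
  fixes g :: "'a poly"
  assumes "p \<in> left_ideal q g" "p = 0 \<or> degree p < degree g"
  shows "p = 0"
proof (rule ccontr)
  assume "p \<noteq> 0"
  obtain h where h: "h \<in> lin_polys q" "p = pcompose h g"
    using assms(1) by (auto simp: left_ideal_def)
  with \<open>p \<noteq> 0\<close> have "h \<noteq> 0" by auto
  then obtain i where "degree h = q ^ i" using degree_lin_poly h by blast
  then have "degree h \<ge> 1" using q_gt_1 by simp
  then have "degree p \<ge> degree g"
    by (simp add: h degree_pcompose)
  with assms(2) \<open>p \<noteq> 0\<close> show False by simp
qed

text \<open>Euclidean division by induction on the degree: a left multiple of \<open>g\<close> by a
  monomial cancels the leading term of \<open>p\<close>.\<close>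

lemma right_division:
  fixes p g :: "'a poly"
  assumes "p \<in> lin_polys q" "g \<in> lin_polys q" "g \<noteq> 0"
  obtains h where "h \<in> lin_polys q" "p - pcompose h g = 0 \<or> degree (p - pcompose h g) < degree g"
proof -
  have "\<exists>h\<in>lin_polys q. p - pcompose h g = 0 \<or> degree (p - pcompose h g) < degree g"
    using assms(1)
  proof (induction "degree p" arbitrary: p rule: less_induct)
    case less
    show ?case
    proof (cases "p = 0 \<or> degree p < degree g")
      case True
      then show ?thesis by (intro bexI[of _ 0]) auto
    next
      case False
      obtain a b where a: "degree p = q ^ a" and b: "degree g = q ^ b"
        using degree_lin_poly less.prems assms(2,3) False by metis
      have ba: "b \<le> a"
        using False q_gt_1 by (simp add: a b)
      \<comment> \<open>Composing \<open>monom c N\<close> with \<open>g\<close> gives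
        \<open>smult c (g ^ N)\<close>. The exponent \<open>N\<close> matches the degree of
        \<open>p\<close>, and \<open>c\<close> compensates for the leading coefficient of
        \<open>g\<close> being raised to the power \<open>N\<close>.\<close>
      define N where "N = q ^ (a - b)"
      define c where "c = lead_coeff p / lead_coeff g ^ N"
      define t where "t = monom c N"
      have t: "t \<in> lin_polys q"
        by (simp add: t_def N_def)
      have tg: "pcompose t g = smult c (g ^ N)"
        by (simp add: t_def pcompose_monom)
      have "c \<noteq> 0"
        using False assms(3) by (simp add: c_def)
      moreover have "N * degree g = degree p"
        using ba by (simp add: N_def a b flip: power_add)
      ultimately have deg: "degree (pcompose t g) = degree p"
        using assms(3) by (simp add: tg degree_power_eq)
      have "lead_coeff (pcompose t g) = lead_coeff p"
        using assms(3) by (simp add: tg lead_coeff_power c_def)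
      then have "coeff (p - pcompose t g) (degree p) = 0"
        by (simp add: deg)
      moreover have "degree (p - pcompose t g) \<le> degree p"
        using degree_diff_le_max[of p "pcompose t g"] deg by simp
      ultimately have *: "p - pcompose t g = 0 \<or> degree (p - pcompose t g) < degree p"
        by (metis leading_coeff_0_iff order_le_less)
      show ?thesis
      proof (cases "p - pcompose t g = 0")
        case True
        then show ?thesis using t by blast
      next
        case False
        with * obtain h where h: "h \<in> lin_polys q"
          "(p - pcompose t g) - pcompose h g = 0 \<or> degree ((p - pcompose t g) - pcompose h g) < degree g"
          using less.hyps[of "p - pcompose t g"] less.prems t assms(2)
          by (auto intro: lin_polys_diff lin_polys_pcompose)
        then show ?thesis
          using t by (intro bexI[of _ "t + h"]) (auto simp: pcompose_add algebra_simps lin_polys_add)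
      qed
    qed
  qed
  with that show ?thesis by blast
qed

text \<open>A nonzero element of least degree generates, since remainders of right division by it
  stay in \<open>I\<close> and must vanish.\<close>

lemma left_ideal_principal:
  fixes I :: "'a poly set"
  assumes sub: "I \<subseteq> lin_polys q" and "0 \<in> I"
    and add: "\<And>x y. x \<in> I \<Longrightarrow> y \<in> I \<Longrightarrow> x + y \<in> I"
    and comp: "\<And>h x. h \<in> lin_polys q \<Longrightarrow> x \<in> I \<Longrightarrow> pcompose h x \<in> I"
  obtains g where "g \<in> I" "I = left_ideal q g"
proof (cases "I = {0}")
  case True
  moreover have "left_ideal q 0 = {0 :: 'a poly}"
  proof -
    show ?thesis
      unfolding left_ideal_def using lin_polys_0 by (auto simp: pcompose_0_right intro: exI[of _ 0])
  qed
  ultimately show ?thesis using that by simp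
next
  case False
  with \<open>0 \<in> I\<close> obtain k where "k \<in> I \<and> k \<noteq> 0" by auto
  then obtain g where g: "g \<in> I" "g \<noteq> 0" and min: "\<And>y. y \<in> I \<Longrightarrow> y \<noteq> 0 \<Longrightarrow> degree g \<le> degree y"
    using ex_has_least_nat[of "\<lambda>k. k \<in> I \<and> k \<noteq> 0" k degree] by auto
  have "I = left_ideal q g"
  proof
    show "left_ideal q g \<subseteq> I"
      using g comp by (auto simp: left_ideal_def)
    show "I \<subseteq> left_ideal q g"
    proof
      fix p assume p: "p \<in> I"
      then obtain h where h: "h \<in> lin_polys q"
        "p - pcompose h g = 0 \<or> degree (p - pcompose h g) < degree g"
        using right_division[of p g] sub g by blast
      \<comment> \<open>Subtraction is expressed through the two assumed closure properties, sums
        and composition from the left.\<close>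
      have "p + pcompose (- h) g \<in> I"
        using p h g by (intro add comp lin_polys_uminus)
      then have "p - pcompose h g \<in> I"
        by (simp add: pcompose_uminus)
      with h min have "p = pcompose h g"
        by force
      with h show "p \<in> left_ideal q g"
        by (auto simp: left_ideal_def)
    qed
  qed
  with g that show ?thesis by blast
qed

text \<open>The combinations of \<open>b\<close> and \<open>f\<close> form a left ideal, hence a
  principal one. Its generator right-divides both, so it right-divides a nonzero scalar multiple of
  \<open>X\<close>; that multiple lies in the ideal, and rescaling gives \<open>X\<close>.\<close>

lemma right_coprime_bezout:
  fixes f b :: "'a poly"
  assumes f: "f \<in> lin_polys q" and b: "b \<in> lin_polys q" and cop: "right_coprime q f b"
  obtains S T where "S \<in> lin_polys q" "T \<in> lin_polys q" "pcompose S b + pcompose T f = [:0, 1:]"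
proof -
  define I where "I = {pcompose S b + pcompose T f | S T. S \<in> lin_polys q \<and> T \<in> lin_polys q}"
  have mem: "pcompose S b + pcompose T f \<in> I" if "S \<in> lin_polys q" "T \<in> lin_polys q" for S T
    using that by (auto simp: I_def)
  have "I \<subseteq> lin_polys q"
    using f b by (auto simp: I_def intro!: lin_polys_add lin_polys_pcompose)
  moreover have "0 \<in> I"
    using mem[of 0 0] by simp
  moreover have "x + y \<in> I" if xy: "x \<in> I" "y \<in> I" for x y
  proof -
    from xy obtain S T S' T' where "x = pcompose S b + pcompose T f" "y = pcompose S' b + pcompose T' f"
      "S \<in> lin_polys q" "T \<in> lin_polys q" "S' \<in> lin_polys q" "T' \<in> lin_polys q"
      unfolding I_def by blast
    then show ?thesis
      using mem[of "S + S'" "T + T'"] by (simp add: lin_polys_add pcompose_add algebra_simps)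
  qed
  moreover have comp: "pcompose h x \<in> I" if hx: "h \<in> lin_polys q" "x \<in> I" for h x
  proof -
    from hx obtain S T where "x = pcompose S b + pcompose T f" "S \<in> lin_polys q" "T \<in> lin_polys q"
      unfolding I_def by blast
    then show ?thesis
      using mem[of "pcompose h S" "pcompose h T"] hx
      by (simp add: lin_polys_pcompose pcompose_add_right pcompose_assoc)
  qed
  ultimately obtain g where g: "g \<in> I" "I = left_ideal q g"
    using left_ideal_principal[of I] by blast
  have X_comp: "pcompose [:0, 1:] p = p" for p :: "'a poly"
    by (simp add: pcompose_pCons)
  have "f \<in> I" "b \<in> I"
    using mem[of 0 "[:0, 1:]"] mem[of "[:0, 1:]" 0] by (simp_all add: X_comp)
  then have "right_divides q g f" "right_divides q g b"
    by (auto simp: g(2) left_ideal_def right_divides_def)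
  moreover obtain c where c: "c \<noteq> 0" "is_gcrd q f b (smult c [:0, 1:])"
    using cop by (auto simp: right_coprime_def)
  ultimately have "right_divides q g (smult c [:0, 1:])"
    using g \<open>I \<subseteq> lin_polys q\<close> unfolding is_gcrd_def by blast
  then have "smult c [:0, 1:] \<in> I"
    unfolding g(2) left_ideal_def right_divides_def by blast
  then have "pcompose (smult (inverse c) [:0, 1:]) (smult c [:0, 1:]) \<in> I"
    by (intro comp lin_polys_smult lin_polys_X)
  also have "pcompose (smult (inverse c) [:0, 1:]) (smult c [:0, 1:]) = [:0, 1:]"
    using c(1) by (simp add: pcompose_pCons)
  finally have "[:0, 1:] \<in> I" .
  with that show ?thesis by (auto simp: I_def)
qed

section \<open>Common left multiples\<close>

text \<open>
  Ore condition: among the infinitely many \<open>X^(q^N)\<close> two have the same remainders modulo all \<open>f i\<close>.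
\<close>

lemma exists_common_left_multiple:
  fixes f :: "'i \<Rightarrow> 'a poly"
  assumes fin: "finite (UNIV :: 'a set)" and "finite A"
    and f: "\<And>i. i \<in> A \<Longrightarrow> f i \<in> lin_polys q \<and> f i \<noteq> 0"
  obtains p where "p \<in> lin_polys q" "p \<noteq> 0" "\<And>i. i \<in> A \<Longrightarrow> p \<in> left_ideal q (f i)"
proof -
  \<comment> \<open>The non-strict degree bound covers a zero remainder as well.\<close>
  have "\<exists>h. h \<in> lin_polys q \<and> degree (monom 1 (q ^ N) - pcompose h (f i)) \<le> degree (f i)"
    if "i \<in> A" for N i
    using right_division[of "monom 1 (q ^ N)" "f i"] f[OF that] lin_polys_monom
    by (metis degree_0 less_imp_le zero_le)
  then have "\<forall>N. \<forall>i\<in>A. \<exists>h. h \<in> lin_polys q \<and> degree (monom 1 (q ^ N) - pcompose h (f i)) \<le> degree (f i)"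
    by blast
  then obtain h where h: "\<And>N i. i \<in> A \<Longrightarrow> h N i \<in> lin_polys q"
    "\<And>N i. i \<in> A \<Longrightarrow> degree (monom 1 (q ^ N) - pcompose (h N i) (f i)) \<le> degree (f i)"
    unfolding bchoice_iff choice_iff by blast
  \<comment> \<open>Restricting to \<open>A\<close> fixes the values elsewhere, so all these tuples
    of remainders lie in one finite extensional product.\<close>
  define \<rho> where "\<rho> N = restrict (\<lambda>i. monom 1 (q ^ N) - pcompose (h N i) (f i)) A" for N
  have "range \<rho> \<subseteq> (\<Pi>\<^sub>E i\<in>A. {p. degree p \<le> degree (f i)})"
    using h by (auto simp: \<rho>_def)
  moreover have "finite (\<Pi>\<^sub>E i\<in>A. {p :: 'a poly. degree p \<le> degree (f i)})"
    by (intro finite_PiE \<open>finite A\<close> finite_degree_le fin)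
  ultimately have "finite (range \<rho>)"
    by (rule finite_subset)
  then have "\<not> inj \<rho>"
    using finite_imageD infinite_UNIV_nat by blast
  then obtain M N where "M \<noteq> N" and eq: "\<rho> M = \<rho> N"
    by (auto simp: inj_def)
  show ?thesis
  proof (rule that)
    let ?p = "monom 1 (q ^ M) - monom 1 (q ^ N) :: 'a poly"
    show "?p \<in> lin_polys q"
      by (simp add: lin_polys_diff)
    have "q ^ M \<noteq> q ^ N"
      using \<open>M \<noteq> N\<close> q_gt_1 by simp
    then have "coeff ?p (q ^ M) = 1" by simp
    then show "?p \<noteq> 0" by (metis coeff_0 zero_neq_one)
    fix i assume i: "i \<in> A"
    with fun_cong[OF eq, of i] have "?p = pcompose (h M i - h N i) (f i)"
      by (simp add: \<rho>_def pcompose_diff algebra_simps)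
    moreover have "h M i - h N i \<in> lin_polys q"
      using h i by (intro lin_polys_diff)
    ultimately show "?p \<in> left_ideal q (f i)"
      unfolding left_ideal_def by blast
  qed
qed

lemma is_lclm_exists:
  fixes F :: "'a poly set"
  assumes "F \<subseteq> lin_polys q"
  obtains l where "is_lclm q F l"
proof -
  let ?I = "lin_polys q \<inter> (\<Inter>f\<in>F. left_ideal q f)"
  obtain l where "l \<in> ?I" "?I = left_ideal q l"
    by (rule left_ideal_principal[of ?I])
      (auto intro: lin_polys_add left_ideal_add lin_polys_pcompose left_ideal_pcompose)
  then have "is_lclm q F l"
    by (auto simp: is_lclm_def)
  with that show ?thesis .
qed

text \<open>The intersection of the ideals contains a nonzero common left multiple, whereas 0
  generates only the zero ideal.\<close>

lemma is_lclm_nonzero: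
  fixes F :: "'a poly set"
  assumes fin: "finite (UNIV :: 'a set)" and F: "finite F" "F \<subseteq> lin_polys q - {0}"
    and l: "is_lclm q F l"
  shows "l \<noteq> 0"
proof
  assume "l = 0"
  obtain p where p: "p \<in> lin_polys q" "p \<noteq> 0" "\<And>f. f \<in> F \<Longrightarrow> p \<in> left_ideal q f"
    using exists_common_left_multiple[OF fin F(1), of "\<lambda>f. f"] F(2) by blast
  then have "p \<in> left_ideal q l"
    using l by (auto simp: is_lclm_def)
  then obtain h where h: "h \<in> lin_polys q" "p = pcompose h l"
    by (auto simp: left_ideal_def)
  with p \<open>l = 0\<close> show False
    by (simp add: pcompose_0_right)
qed


section \<open>The Chinese remainder lifting\<close>

text \<open>Modulo the left ideal of \<open>f j\<close>, the polynomials \<open>l\<close> and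
  \<open>b i\<close> for \<open>i\<close> other than \<open>j\<close> vanish, being left multiples
  of \<open>f j\<close>. The remaining summand is congruent to \<open>e j\<close> by the Bezout
  identity.\<close>

lemma crt_remainder_congruent:
  fixes f b e S T :: "nat \<Rightarrow> 'a poly"
  assumes b: "\<And>i. i \<in> {1..s} \<Longrightarrow> is_lclm q (f ` ({1..s} - {i})) (b i)"
    and e: "\<And>i. i \<in> {1..s} \<Longrightarrow> e i \<in> lin_polys q"
    and ST: "\<forall>i\<in>{1..s}. S i \<in> lin_polys q \<and> T i \<in> lin_polys q \<and>
       pcompose (S i) (b i) + pcompose (T i) (f i) = [:0, 1:]"
    and l: "is_lclm q (f ` {1..s}) l"
    and r: "is_right_remainder q (\<Sum>i=1..s. pcompose (pcompose (e i) (S i)) (b i)) l r"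
    and j: "j \<in> {1..s}"
  shows "r - e j \<in> left_ideal q (f j)"
proof -
  let ?t = "\<lambda>i. pcompose (pcompose (e i) (S i)) (b i)"
  obtain h where h: "h \<in> lin_polys q" "(\<Sum>i=1..s. ?t i) = pcompose h l + r"
    using r by (auto simp: is_right_remainder_def)
  have "l \<in> left_ideal q (f j)"
    using l j left_ideal_generator[of l] by (auto simp: is_lclm_def)
  then have hl: "pcompose h l \<in> left_ideal q (f j)"
    using h by (intro left_ideal_pcompose)
  have others: "?t i \<in> left_ideal q (f j)" if i: "i \<in> {1..s} - {j}" for i
  proof -
    have "b i \<in> left_ideal q (f j)"
      using b[of i] i j left_ideal_generator[of "b i"] by (auto simp: is_lclm_def)
    then show ?thesis
      using i e ST by (intro left_ideal_pcompose lin_polys_pcompose) auto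
  qed
  have "pcompose (S j) (b j) = [:0, 1:] - pcompose (T j) (f j)"
    using ST j by (metis add_diff_cancel_right')
  \<comment> \<open>Composing the Bezout identity with \<open>e j\<close> from the left needs
    additivity of \<open>e j\<close>, hence that \<open>e j\<close> is linearized.\<close>
  then have "?t j = e j - pcompose (pcompose (e j) (T j)) (f j)"
    using pcompose_diff_right[OF e[OF j]] by (simp flip: pcompose_assoc)
  moreover have "pcompose (pcompose (e j) (T j)) (f j) \<in> left_ideal q (f j)"
    using ST e j by (intro left_ideal_pcompose lin_polys_pcompose left_ideal_generator) auto
  ultimately have tj: "e j - ?t j \<in> left_ideal q (f j)"
    by simp
  have "(\<Sum>i=1..s. ?t i) = ?t j + (\<Sum>i\<in>{1..s} - {j}. ?t i)"
    using j by (intro sum.remove) auto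
  then have "r - e j = (\<Sum>i\<in>{1..s} - {j}. ?t i) - (e j - ?t j) - pcompose h l"
    using h(2) by (simp add: algebra_simps)
  also have "\<dots> \<in> left_ideal q (f j)"
    by (intro left_ideal_diff left_ideal_sum others tj hl)
  finally show ?thesis .
qed

text \<open>The difference lies in the intersection of the ideals, which \<open>l\<close> generates,
  and has smaller degree than \<open>l\<close>. Two generators are allowed because
  \<open>crt_lift\<close> does not fix the least left common multiple.\<close>

lemma crt_unique:
  fixes f :: "nat \<Rightarrow> 'a poly"
  assumes l: "is_lclm q (f ` A) l" "is_lclm q (f ` A) l'" and nz: "l \<noteq> 0" "l' \<noteq> 0"
    and r: "r \<in> lin_polys_lt q (qdegree q l)" "r' \<in> lin_polys_lt q (qdegree q l')"
    and eq: "\<And>i. i \<in> A \<Longrightarrow> r - r' \<in> left_ideal q (f i)"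
  shows "r = r'"
proof -
  have lin: "l \<in> lin_polys q" "l' \<in> lin_polys q" and same: "left_ideal q l = left_ideal q l'"
    using l by (auto simp: is_lclm_def)
  \<comment> \<open>Were one degree smaller, that generator would be zero, as it lies in the ideal
    of the other.\<close>
  have "degree l = degree l'"
    using left_ideal_degree_less[of l l'] left_ideal_degree_less[of l' l] nz same
      left_ideal_generator[of l] left_ideal_generator[of l'] by (metis linorder_neqE_nat)
  moreover note lin_polys_lt_qdegree_iff[OF q_gt_1 lin(1) nz(1), of r]
    lin_polys_lt_qdegree_iff[OF q_gt_1 lin(2) nz(2), of r'] r
  ultimately have rr: "r \<in> lin_polys q" "r' \<in> lin_polys q"
    "r = 0 \<or> degree r < degree l" "r' = 0 \<or> degree r' < degree l"
    by auto
  then have "r - r' = 0 \<or> degree (r - r') < degree l"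
    using degree_diff_less[of r "degree l" r'] by auto
  moreover have "r - r' \<in> left_ideal q l"
    using l(1) eq rr lin_polys_diff by (auto simp: is_lclm_def)
  ultimately have "r - r' = 0"
    using left_ideal_degree_less by blast
  then show ?thesis by simp
qed

text \<open>This shows that the definite description denotes and extracts the properties that
  determine the lift: its degree bound and its congruences. Existence comes from Bezout identities
  and right division, uniqueness from \<open>crt_unique\<close>.\<close>

lemma crt_lift_characterization:
  fixes f b e :: "nat \<Rightarrow> 'a poly"
  assumes fin: "finite (UNIV :: 'a set)"
    and f: "\<And>i. i \<in> {1..s} \<Longrightarrow> f i \<in> lin_polys q \<and> f i \<noteq> 0"
    and b: "\<And>i. i \<in> {1..s} \<Longrightarrow> is_lclm q (f ` ({1..s} - {i})) (b i)"
    and cop: "\<And>i. i \<in> {1..s} \<Longrightarrow> right_coprime q (f i) (b i)"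
    and e: "\<And>i. i \<in> {1..s} \<Longrightarrow> e i \<in> lin_polys q"
  obtains l where "is_lclm q (f ` {1..s}) l" "l \<noteq> 0"
    "crt_lift q s f b e \<in> lin_polys_lt q (qdegree q l)"
    "\<And>i. i \<in> {1..s} \<Longrightarrow> crt_lift q s f b e - e i \<in> left_ideal q (f i)"
proof -
  define R where "R r S T l \<longleftrightarrow>
     (\<forall>i\<in>{1..s}. S i \<in> lin_polys q \<and> T i \<in> lin_polys q \<and>
        pcompose (S i) (b i) + pcompose (T i) (f i) = [:0, 1:]) \<and>
     is_lclm q (f ` {1..s}) l \<and>
     is_right_remainder q (\<Sum>i=1..s. pcompose (pcompose (e i) (S i)) (b i)) l r" for r S T l
  have crt: "crt_lift q s f b e = (THE r. \<exists>S T l. R r S T l)"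
    by (simp add: crt_lift_def R_def)
  have b_lin: "b i \<in> lin_polys q" if "i \<in> {1..s}" for i
    using b[OF that] by (simp add: is_lclm_def)
  have nz: "l \<noteq> 0" if "is_lclm q (f ` {1..s}) l" for l
    by (rule is_lclm_nonzero[OF fin _ _ that]) (use f in auto)
  have R_lt: "r \<in> lin_polys_lt q (qdegree q l)" if "R r S T l" for r S T l
    using that by (auto simp: R_def is_right_remainder_def)
  have R_cong: "r - e i \<in> left_ideal q (f i)" if "R r S T l" "i \<in> {1..s}" for r S T l i
    by (rule crt_remainder_congruent[of s f b e S T l r i]) (use b e that in \<open>simp_all add: R_def\<close>)
  have "\<exists>S T. S \<in> lin_polys q \<and> T \<in> lin_polys q \<and> pcompose S (b i) + pcompose T (f i) = [:0, 1:]"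
    if "i \<in> {1..s}" for i
    by (rule right_coprime_bezout[of "f i" "b i"]) (use f b_lin cop that in auto)
  then have "\<forall>i\<in>{1..s}. \<exists>S T. S \<in> lin_polys q \<and> T \<in> lin_polys q \<and>
        pcompose S (b i) + pcompose T (f i) = [:0, 1:]"
    by blast
  from bchoice[OF this] obtain S where "\<forall>i\<in>{1..s}. \<exists>T. S i \<in> lin_polys q \<and> T \<in> lin_polys q \<and>
        pcompose (S i) (b i) + pcompose T (f i) = [:0, 1:]" ..
  from bchoice[OF this] obtain T where ST: "\<forall>i\<in>{1..s}. S i \<in> lin_polys q \<and> T i \<in> lin_polys q \<and>
        pcompose (S i) (b i) + pcompose (T i) (f i) = [:0, 1:]" ..
  obtain l where l: "is_lclm q (f ` {1..s}) l"
    by (rule is_lclm_exists[of "f ` {1..s}"]) (use f in auto)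
  let ?p = "\<Sum>i=1..s. pcompose (pcompose (e i) (S i)) (b i)"
  have p: "?p \<in> lin_polys q"
    using e ST b_lin by (intro lin_polys_sum lin_polys_pcompose) auto
  moreover have "l \<in> lin_polys q"
    using l by (simp add: is_lclm_def)
  ultimately obtain h where h: "h \<in> lin_polys q"
    "?p - pcompose h l = 0 \<or> degree (?p - pcompose h l) < degree l"
    using right_division[of ?p l] nz[OF l] by blast
  have "?p - pcompose h l \<in> lin_polys_lt q (qdegree q l)"
    unfolding lin_polys_lt_qdegree_iff[OF q_gt_1 \<open>l \<in> lin_polys q\<close> nz[OF l]]
    using h p \<open>l \<in> lin_polys q\<close> by (intro conjI lin_polys_diff lin_polys_pcompose) auto
  then have "is_right_remainder q ?p l (?p - pcompose h l)"
    unfolding is_right_remainder_def using h(1) by (intro conjI bexI[of _ h]) simp_all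
  then have R0: "R (?p - pcompose h l) S T l"
    using ST l by (simp add: R_def)
  \<comment> \<open>The Bezout coefficients and the least left common multiple may all differ; both
    candidates are still congruent to every \<open>e i\<close>.\<close>
  have "r = r'" if "R r S T l" "R r' S' T' l'" for r r' S S' T T' l l'
  proof (rule crt_unique)
    show l: "is_lclm q (f ` {1..s}) l" and l': "is_lclm q (f ` {1..s}) l'"
      using that by (auto simp: R_def)
    show "l \<noteq> 0" "l' \<noteq> 0"
      using nz l l' by auto
    show "r \<in> lin_polys_lt q (qdegree q l)" "r' \<in> lin_polys_lt q (qdegree q l')"
      using R_lt that by auto
    fix i assume "i \<in> {1..s}"
    then have "(r - e i) - (r' - e i) \<in> left_ideal q (f i)"
      using left_ideal_diff[OF R_cong[OF that(1)] R_cong[OF that(2)]] by blast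
    then show "r - r' \<in> left_ideal q (f i)" by simp
  qed
  then have "crt_lift q s f b e = ?p - pcompose h l"
    unfolding crt using R0 by (intro the_equality) blast+
  then show ?thesis
    using that[of l] l nz[OF l] R_lt[OF R0] R_cong[OF R0] by simp
qed

lemma supp_crt_lift_subset:
  fixes f b e :: "nat \<Rightarrow> 'a poly" and K :: "'a set"
  assumes fin: "finite (UNIV :: 'a set)" and K: "subfield_set K"
    and f: "\<And>i. i \<in> {1..s} \<Longrightarrow> f i \<in> linearized q K \<and> f i \<noteq> 0"
    and b: "\<And>i. i \<in> {1..s} \<Longrightarrow> is_lclm q (f ` ({1..s} - {i})) (b i)"
    and cop: "\<And>i. i \<in> {1..s} \<Longrightarrow> right_coprime q (f i) (b i)"
    and e: "\<And>i. i \<in> {1..s} \<Longrightarrow> e i \<in> lin_polys q"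
  shows "supp K (crt_lift q s f b e) \<subseteq> supp_tuple K s e"
proof -
  let ?r = "crt_lift q s f b e" and ?V = "supp_tuple K s e"
  have f_lin: "f i \<in> lin_polys q \<and> f i \<noteq> 0" if "i \<in> {1..s}" for i
    using f[OF that] by (auto simp: linearized_def)
  obtain l where l: "is_lclm q (f ` {1..s}) l" and "l \<noteq> 0"
    and r: "?r \<in> lin_polys_lt q (qdegree q l)"
    and cong: "\<And>i. i \<in> {1..s} \<Longrightarrow> ?r - e i \<in> left_ideal q (f i)"
    using crt_lift_characterization[where s = s and f = f and b = b and e = e] fin f_lin b cop e
    by blast
  have l_lin: "l \<in> lin_polys q"
    using l by (simp add: is_lclm_def)
  note lt_iff = lin_polys_lt_qdegree_iff[OF q_gt_1 l_lin \<open>l \<noteq> 0\<close>]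
  have V: "subspace_over K ?V"
    by (simp add: supp_tuple_def subspace_over_span_over)
  have coeff_e: "coeff (e i) k \<in> ?V" if "i \<in> {1..s}" for i k
    unfolding supp_tuple_def span_over_def using that by (intro hull_inc) blast
  have "coeff ?r k \<in> ?V" for k
  proof (rule ccontr)
    assume "coeff ?r k \<notin> ?V"
    then obtain \<phi> :: "'a \<Rightarrow> 'a" where add: "\<And>a b. \<phi> (a + b) = \<phi> a + \<phi> b"
      and mult: "\<And>c a. c \<in> K \<Longrightarrow> \<phi> (c * a) = c * \<phi> a"
      and V0: "\<And>v. v \<in> ?V \<Longrightarrow> \<phi> v = 0" and nonzero: "\<phi> (coeff ?r k) \<noteq> 0"
      by (rule exists_separating_functional[OF fin K V]) (rule that)
    have zero: "\<phi> 0 = 0"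
      using add[of 0 0] by (metis add.right_neutral add_cancel_left_right)
    \<comment> \<open>The subtracted 0 puts the congruence into the form in which
      \<open>crt_unique\<close> compares \<open>map_poly \<phi> ?r\<close> with 0.\<close>
    have "map_poly \<phi> ?r - 0 \<in> left_ideal q (f i)" if i: "i \<in> {1..s}" for i
    proof -
      obtain h where h: "h \<in> lin_polys q" "?r - e i = pcompose h (f i)"
        using cong[OF i] by (auto simp: left_ideal_def)
      then have "?r = pcompose h (f i) + e i"
        by (simp add: algebra_simps)
      \<comment> \<open>The coefficients of \<open>e i\<close> lie in \<open>?V\<close>, which
        \<open>\<phi>\<close> annihilates, so only the composite survives.\<close>
      then have "map_poly \<phi> ?r = map_poly \<phi> (pcompose h (f i))"
        by (intro poly_eqI) (simp add: coeff_map_poly zero add V0 coeff_e[OF i])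
      also have "\<dots> = pcompose (map_poly \<phi> h) (f i)"
        using f[OF i] by (intro map_poly_pcompose_linear[where K = K] add mult) (auto simp: linearized_def)
      finally show ?thesis
        using lin_polys_map_poly[of h q \<phi>, OF h(1) zero] by (auto simp: left_ideal_def)
    qed
    moreover have "map_poly \<phi> ?r \<in> lin_polys_lt q (qdegree q l)"
    proof -
      \<comment> \<open>A coefficientwise map fixing 0 creates no new exponents, so the degree bound
        is inherited.\<close>
      have "degree (map_poly \<phi> ?r) \<le> degree ?r"
        by (rule degree_le) (simp add: coeff_map_poly zero coeff_eq_0)
      with r show ?thesis
        unfolding lt_iff by (auto simp: lin_polys_map_poly zero)
    qed
    moreover have "0 \<in> lin_polys_lt q (qdegree q l)"
      by (simp add: lt_iff)
    ultimately have "map_poly \<phi> ?r = 0"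
      using crt_unique[OF l l \<open>l \<noteq> 0\<close> \<open>l \<noteq> 0\<close>] by blast
    then have "coeff (map_poly \<phi> ?r) k = 0" by simp
    with nonzero show False by (simp add: coeff_map_poly zero)
  qed
  then show ?thesis
    unfolding supp_def span_over_def[of K "range (coeff ?r)"]
    by (intro hull_minimal V) auto
qed

end

section \<open>The Frobenius map over the finite field\<close>

text \<open>The characteristic is a prime dividing the cardinality, a power of the prime
  \<open>p\<close> below \<open>q\<close>, so it equals \<open>p\<close>. The freshman's dream for
  powers of \<open>p\<close> then applies to polynomials.\<close>

lemma finite_field_power_add:
  fixes x y :: "'a::field poly"
  assumes "primepow q" "CARD('a) = q ^ m"
  shows "(x + y) ^ q = x ^ q + y ^ q"
proof -
  obtain p k where p: "prime p" "q = p ^ k"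
    using assms(1) by (auto simp: primepow_def)
  then have "finite (UNIV :: 'a set)"
    using assms(2) by (intro card_ge_0_finite) (simp add: prime_gt_0_nat)
  then have CHAR: "prime CHAR('a)"
    by (intro prime_CHAR_semidom finite_imp_CHAR_pos)
  \<comment> \<open>Shifting by 1 permutes the field, so the sum of all elements is unchanged; but
    it also grows by the cardinality, which is therefore 0 in the field.\<close>
  have "(\<Sum>z\<in>(UNIV :: 'a set). z + 1) = (\<Sum>z\<in>UNIV. z)"
    by (rule sum.reindex_bij_witness[of _ "\<lambda>z. z - 1" "\<lambda>z. z + 1"]) auto
  then have "of_nat CARD('a) = (0 :: 'a)"
    by (simp add: sum.distrib)
  then have "CHAR('a) dvd p ^ (k * m)"
    using assms(2) p by (simp add: of_nat_eq_0_iff_char_dvd power_mult flip: of_nat_power)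
  then have "CHAR('a) = p"
    using CHAR p(1) by (metis prime_dvd_power primes_dvd_imp_eq)
  with CHAR p show ?thesis
    by (intro freshmans_dream'[where n = k]) simp_all
qed

theorem proposition24:
  fixes q m s n :: nat
    and Fq :: "'a::field set"
    and d :: "nat \<Rightarrow> nat"
    and f b e :: "nat \<Rightarrow> 'a poly"
  assumes "primepow q" and "m \<ge> 1"
    and "CARD('a) = q ^ m"
    and "subfield_set Fq" and "card Fq = q"
    and "\<And>i. i \<in> {1..s} \<Longrightarrow> f i \<in> linearized q Fq \<and> f i \<noteq> 0 \<and> qdegree q (f i) = d i"
    and "n = (\<Sum>i=1..s. d i)"
    and "\<And>i. i \<in> {1..s} \<Longrightarrow> is_lclm q (f ` ({1..s} - {i})) (b i)"
    and "\<And>i. i \<in> {1..s} \<Longrightarrow> right_coprime q (f i) (b i)"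
    and "\<And>i. i \<in> {1..s} \<Longrightarrow> e i \<in> lin_polys_lt q (d i)"
  shows "supp Fq (crt_lift q s f b e) \<subseteq> supp_tuple Fq s e"
proof (rule supp_crt_lift_subset)
  \<comment> \<open>The goals include the standing assumptions of the context, \<open>1 < q\<close>
    and additivity of the \<open>q\<close>-th power.\<close>
  show "1 < q"
    using primepow_gt_Suc_0[OF assms(1)] by simp
  then show "finite (UNIV :: 'a set)"
    using assms(3) by (intro card_ge_0_finite) simp
  show "(x + y) ^ q = x ^ q + y ^ q" for x y :: "'a poly"
    by (rule finite_field_power_add[OF assms(1,3)])
  show "e i \<in> lin_polys q" if "i \<in> {1..s}" for i
    using assms(10)[OF that] by (simp add: lin_polys_lt_def)
qed (use assms in auto)

end
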